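(* Let $C>1$ be an integer. For all $j\in[t]$, let $G^{(j)}$ be a connected graph with $1<|V(G^{(j)})|\le C$. Let $G=\square_{j=1}^t G^{(j)}$ and let $n:=|V(G)|$. Then for any $k\in[n]$, $$i_k(G)\ge \frac{1}{C-1}\log_C\left(\frac{n}{k}\right).$$
   Context: Graphs are finite and simple; $[m]=\{1,\ldots,m\}$. The Cartesian product $\square_{j=1}^t G^{(j)}$ of graphs $G^{(1)},\ldots,G^{(t)}$ is the graph with vertex set $V(G^{(1)})\times\cdots\times V(G^{(t)})$ in which $u$ and $v$ are adjacent iff there is some $j\in[t]$ with $u_jv_j\in E(G^{(j)})$ and $u_m=v_m$ for all $m\ne j$. For $S\subseteq V(G)$, $\partial(S)$ is the set of edges of $G$ with one endpoint in $S$ and the other in $V(G)\setminus S$. For $k\in[|V(G)|]$, $i_k(G):=\min\{|\partial(S)|/k : S\subseteq V(G),\ |S|=k\}$. *)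

theory Defs
  imports Complex_Main "HOL-Library.FuncSet" "Graph_Theory.Graph_Theory"
begin

text \<open>
  A finite simple graph is a \<^locale>\<open>pair_graph\<close>: a finite loop-free symmetric arc relation on
  a vertex set. An undirected edge with endpoints \<open>u\<close> and \<open>v\<close> is therefore represented by the two
  arcs \<open>(u, v)\<close> and \<open>(v, u)\<close>.

  The vertices of a Cartesian product are tuples indexed by \<open>I\<close>, i.e. extensional functions.
\<close>

definition cartesian_product_graph ::
    "'i set \<Rightarrow> ('i \<Rightarrow> 'a pair_pre_digraph) \<Rightarrow> ('i \<Rightarrow> 'a) pair_pre_digraph" where
  "cartesian_product_graph I G =
    \<lparr> pverts = (\<Pi>\<^sub>E j\<in>I. pverts (G j)),
      parcs = {(u, v). u \<in> (\<Pi>\<^sub>E j\<in>I. pverts (G j)) \<and> v \<in> (\<Pi>\<^sub>E j\<in>I. pverts (G j)) \<and>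
        (\<exists>j\<in>I. (u j, v j) \<in> parcs (G j) \<and> (\<forall>m\<in>I. m \<noteq> j \<longrightarrow> u m = v m))} \<rparr>"

lemma pair_graph_cartesian_product_graph:
  fixes I :: "'i set" and G :: "'i \<Rightarrow> 'a pair_pre_digraph"
  assumes "finite I" and G: "\<And>j. j \<in> I \<Longrightarrow> pair_graph (G j)"
  shows "pair_graph (cartesian_product_graph I G)"
proof -
  let ?P = "cartesian_product_graph I G"
  have fin_factor: "finite (pverts (G j))" if "j \<in> I" for j
  proof -
    interpret pair_graph "G j" using G that .
    show ?thesis by (rule pair_finite_verts)
  qed
  have fin: "finite (pverts ?P)"
    using assms(1) fin_factor by (simp add: cartesian_product_graph_def finite_PiE)
  have sub: "parcs ?P \<subseteq> pverts ?P \<times> pverts ?P"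
    by (auto simp: cartesian_product_graph_def)
  have symm_factor: "(y, x) \<in> parcs (G j)" if "(x, y) \<in> parcs (G j)" "j \<in> I" for x y j
  proof -
    interpret pair_graph "G j" using G that(2) .
    show ?thesis using pair_sym_arcs that(1) by (simp add: symmetric_def sym_def)
  qed
  have loop_factor: "(x, x) \<notin> parcs (G j)" if "j \<in> I" for x j
  proof -
    interpret pair_graph "G j" using G that .
    show ?thesis using pair_no_loops by fastforce
  qed
  have symm: "(v, u) \<in> parcs ?P" if "(u, v) \<in> parcs ?P" for u v
  proof -
    from that obtain j where j: "j \<in> I" "(u j, v j) \<in> parcs (G j)" "\<forall>m\<in>I. m \<noteq> j \<longrightarrow> u m = v m"
      and "u \<in> pverts ?P" "v \<in> pverts ?P"
      by (auto simp: cartesian_product_graph_def)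
    moreover have "(v j, u j) \<in> parcs (G j)" using symm_factor j(2,1) .
    moreover have "\<forall>m\<in>I. m \<noteq> j \<longrightarrow> v m = u m" using j(3) by simp
    ultimately show ?thesis
      unfolding cartesian_product_graph_def by simp blast
  qed
  have loop: "(u, u) \<notin> parcs ?P" for u
    using loop_factor by (auto simp: cartesian_product_graph_def)
  show ?thesis
  proof unfold_locales
    fix e assume e: "e \<in> parcs ?P"
    show "fst e \<in> pverts ?P" "snd e \<in> pverts ?P" using e sub by auto
    show "fst e \<noteq> snd e" using e loop by (metis prod.collapse)
  next
    show "finite (pverts ?P)" by (rule fin)
    show "finite (parcs ?P)" using sub fin by (meson finite_SigmaI finite_subset)
    show "symmetric (with_proj ?P)" using symm by (simp add: symmetric_def sym_def)
  qed
qed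

text \<open>Boundary edges are collected as unordered pairs, so that each edge is counted once.\<close>

definition edge_boundary :: "'a pair_pre_digraph \<Rightarrow> 'a set \<Rightarrow> 'a set set" where
  "edge_boundary G S = {{u, v} | u v. (u, v) \<in> parcs G \<and> u \<in> S \<and> v \<in> pverts G - S}"

text \<open>Only meaningful for \<open>1 \<le> k \<le> card (pverts G)\<close>; otherwise the division or the minimum
  degenerates.\<close>

definition isoperimetric_number :: "nat \<Rightarrow> 'a pair_pre_digraph \<Rightarrow> real" where
  "isoperimetric_number k G =
    Min {real (card (edge_boundary G S)) / real k | S. S \<subseteq> pverts G \<and> card S = k}"

end

theory Submission
  imports Defs
begin

text \<open>
  Induct on the number of factors. Cut a set \<open>S\<close> in a product \<open>G' \<box> H\<close> into its slices \<open>T x\<close>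
  over the vertices \<open>x\<close> of \<open>H\<close>. The arcs in direction \<open>G'\<close> contribute the boundaries of the slices.
  If \<open>T p\<close> is a largest and \<open>T q\<close> a smallest slice, then for each \<open>u \<in> T p - T q\<close> the fibre
  \<open>{u} \<times> H\<close> meets both \<open>S\<close> and its complement, so by connectedness it contains a boundary arc;
  the direction \<open>H\<close> thus contributes at least \<open>|T p| - |T q|\<close>. What remains is the inequality
  \<open>entropy_max_min_bound\<close> for the slice sizes \<open>a x\<close>. With \<open>r x\<close> the ratio of \<open>a x\<close> to the mean, it
  bounds \<open>\<Sum>x. a x * ln (r x)\<close>: write \<open>a x = a q + (a x - a q)\<close> and use \<open>ln (r x) \<le> r x - 1\<close> (which
  sums to 0) in the first part and \<open>r x \<le> m\<close>, for \<open>m\<close> the number of slices, in the second.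
\<close>

section \<open>The entropy inequality for slice sizes\<close>

lemma entropy_max_min_bound:
  fixes a :: "'b \<Rightarrow> real" and N :: real
  assumes fin: "finite X" and p: "p \<in> X" and q: "q \<in> X"
    and bounds: "\<And>x. x \<in> X \<Longrightarrow> a q \<le> a x \<and> a x \<le> a p"
    and nonneg: "a q \<ge> 0" and pos: "sum a X > 0" and N: "N > 0"
  shows "sum a X * ln (real (card X) * N / sum a X)
    \<le> (\<Sum>x\<in>X. a x * ln (N / a x)) + (real (card X) - 1) * ln (real (card X)) * (a p - a q)"
proof -
  define m where "m = real (card X)"
  define s where "s = sum a X"
  define r where "r x = m * a x / s" for x
  have m1: "m \<ge> 1" unfolding m_def using fin p by (metis One_nat_def Suc_leI card_gt_0_iff empty_iff of_nat_1 of_nat_le_iff)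
  have s0: "s > 0" using pos s_def by simp
  have nn: "a x \<ge> 0" if "x \<in> X" for x using bounds[OF that] nonneg by linarith
  \<comment> \<open>\<open>r x\<close> is the quotient of the two arguments of \<open>ln\<close>, so
    \<open>N\<close> cancels. If \<open>a x = 0\<close>, the factor \<open>a x\<close> makes both
    sides 0, whatever the logarithms are.\<close>
  have "a x * ln (m * N / s) - a x * ln (N / a x) = a x * ln (r x)" if "x \<in> X" for x
  proof (cases "a x = 0")
    case False
    then have "a x > 0" using nn that by force
    then show ?thesis using m1 s0 N
      by (simp add: r_def ln_mult ln_div algebra_simps)
  qed simp
  then have "s * ln (m * N / s) - (\<Sum>x\<in>X. a x * ln (N / a x)) = (\<Sum>x\<in>X. a x * ln (r x))"
    unfolding s_def sum_distrib_right sum_subtractf[symmetric] by (intro sum.cong) auto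
  also have "\<dots> = (\<Sum>x\<in>X. a q * ln (r x)) + (\<Sum>x\<in>X. (a x - a q) * ln (r x))"
    by (simp add: sum.distrib[symmetric] algebra_simps)
  also have "(\<Sum>x\<in>X. a q * ln (r x)) \<le> (\<Sum>x\<in>X. a q * (r x - 1))"
  proof (rule sum_mono)
    fix x assume x: "x \<in> X"
    show "a q * ln (r x) \<le> a q * (r x - 1)"
    proof (cases "a q = 0")
      case False
      then have "a x > 0" using bounds[OF x] nonneg by linarith
      then have "r x > 0" using m1 s0 by (simp add: r_def)
      then show ?thesis using ln_le_minus_one nonneg by (intro mult_left_mono)
    qed simp
  qed
  also have "\<dots> = a q * (m * s / s - m)"
    by (simp add: sum_distrib_left[symmetric] sum_subtractf r_def s_def m_def
        sum_divide_distrib[symmetric])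
  also have "\<dots> = 0" using s0 by simp
  \<comment> \<open>The term at \<open>q\<close> vanishes. Leaving it out makes the constant
    \<open>m - 1\<close> instead of \<open>m\<close>.\<close>
  also have "(\<Sum>x\<in>X. (a x - a q) * ln (r x)) \<le> (\<Sum>x\<in>X - {q}. (a p - a q) * ln m)"
  proof -
    have "(\<Sum>x\<in>X. (a x - a q) * ln (r x)) = (\<Sum>x\<in>X - {q}. (a x - a q) * ln (r x))"
      using fin q by (simp add: sum.remove)
    also have "\<dots> \<le> (\<Sum>x\<in>X - {q}. (a p - a q) * ln m)"
    proof (rule sum_mono)
      fix x assume "x \<in> X - {q}"
      then have x: "x \<in> X" by simp
      show "(a x - a q) * ln (r x) \<le> (a p - a q) * ln m"
      \<comment> \<open>The case split secures \<open>a x > 0\<close>, hence \<open>r x > 0\<close>,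
        before logarithms are compared.\<close>
      proof (cases "a x = a q")
        case True
        then show ?thesis using bounds[OF p] m1 by simp
      next
        case False
        then have ax: "a x > 0" "a x \<ge> a q" using bounds[OF x] nonneg by linarith+
        have "a x \<le> s" unfolding s_def using fin nn by (intro member_le_sum x) auto
        then have "r x \<le> m" using m1 s0 by (simp add: r_def field_simps)
        moreover have "r x > 0" using ax m1 s0 by (simp add: r_def)
        ultimately have "ln (r x) \<le> ln m" by simp
        then have "(a x - a q) * ln (r x) \<le> (a x - a q) * ln m"
          using ax by (intro mult_left_mono) auto
        also have "\<dots> \<le> (a p - a q) * ln m"
          using bounds[OF x] m1 by (intro mult_right_mono) auto
        finally show ?thesis .
      qed
    qed
    finally show ?thesis .
  qed
  also have "\<dots> = (m - 1) * ln m * (a p - a q)"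
    using fin q m1 unfolding m_def by (simp add: card_Diff_singleton of_nat_diff)
  finally show ?thesis unfolding m_def s_def by simp
qed

section \<open>Boundary arcs\<close>

text \<open>A path from \<open>a\<close> to \<open>b\<close> has a first vertex outside
  \<open>A\<close>, and the arc into it leaves \<open>A\<close>. Symmetry of the arc relation turns
  connectedness into a directed path.\<close>

lemma connected_arc_leaving:
  fixes H :: "'a pair_pre_digraph"
  assumes "pair_graph H" and "Digraph_Component.connected (with_proj H)"
    and a: "a \<in> pverts H" "a \<in> A" and b: "b \<in> pverts H" "b \<notin> A"
  obtains c d where "(c, d) \<in> parcs H" "c \<in> A" "d \<notin> A"
proof -
  interpret pair_graph H by fact
  have "a \<rightarrow>\<^sup>*\<^bsub>with_proj H\<^esub> b"
    using assms(2) a(1) b(1) symmetric_connected_imp_strongly_connected[OF sym_arcs]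
    by (auto elim: strongly_connectedE)
  then have "\<exists>c d. (c, d) \<in> parcs H \<and> c \<in> A \<and> d \<notin> A"
    using a b(2)
  proof (induction rule: reachable_induct)
    case base
    then show ?case by simp
  next
    case (step x y)
    then show ?case by (cases "x \<in> A") auto
  qed
  then show thesis using that by blast
qed

text \<open>Oriented form of the edge boundary: each edge is represented by its arc pointing out of
  \<open>S\<close>, so arcs of a product can be counted coordinatewise.\<close>

definition arc_boundary :: "'a pair_pre_digraph \<Rightarrow> 'a set \<Rightarrow> ('a \<times> 'a) set" where
  "arc_boundary G S = {(u, v) \<in> parcs G. u \<in> S \<and> v \<notin> S}"

text \<open>Exactly one endpoint of a boundary edge lies in \<open>S\<close>, so the unordered pair
  determines its orientation.\<close>

lemma card_edge_boundary:
  assumes "pair_graph G"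
  shows "card (edge_boundary G S) = card (arc_boundary G S)"
proof -
  interpret pair_graph G by fact
  have "edge_boundary G S = (\<lambda>(u, v). {u, v}) ` arc_boundary G S"
    unfolding edge_boundary_def arc_boundary_def
    using in_arcsD2 by (auto simp: image_iff)
  moreover have "inj_on (\<lambda>(u, v). {u, v}) (arc_boundary G S)"
    by (auto simp: inj_on_def arc_boundary_def doubleton_eq_iff)
  ultimately show ?thesis by (simp add: card_image)
qed

section \<open>The induction over the factors\<close>

lemma PiE_upd_undefined:
  assumes "j \<notin> I" "u \<in> PiE I V"
  shows "(u(j := x))(j := undefined) = u"
  using PiE_arb[OF assms(2,1)] by (simp add: fun_upd_idem)

text \<open>Multiplying the claim out by \<open>card S\<close> and \<open>ln C\<close> makes it hold
  for empty \<open>S\<close> too; the induction needs this because slices may be empty.\<close>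

lemma card_arc_boundary_product:
  fixes G :: "'i \<Rightarrow> 'a pair_pre_digraph"
  assumes C: "C > 1" and "finite I"
    and "\<And>j. j \<in> I \<Longrightarrow> pair_graph (G j)"
    and "\<And>j. j \<in> I \<Longrightarrow> Digraph_Component.connected (with_proj (G j))"
    and "\<And>j. j \<in> I \<Longrightarrow> 1 < card (pverts (G j)) \<and> card (pverts (G j)) \<le> C"
    and "S \<subseteq> (\<Pi>\<^sub>E j\<in>I. pverts (G j))"
  shows "real (card S) * ln (real (card (\<Pi>\<^sub>E j\<in>I. pverts (G j))) / real (card S))
    \<le> (real C - 1) * ln (real C) * real (card (arc_boundary (cartesian_product_graph I G) S))"
  using assms(2-)
proof (induction I arbitrary: S rule: finite_induct)
  case empty
  \<comment> \<open>The empty product has one vertex, so the left side is 0: either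
    \<open>card S = 0\<close> or the logarithm is \<open>ln 1\<close>.\<close>
  then have "S = {} \<or> S = {\<lambda>_. undefined}" by auto
  then show ?case using C by auto
next
  case (insert j I)
  show ?case
  proof (cases "S = {}")
    case True
    then show ?thesis using C by simp
  next
    case False
    define V where "V i = pverts (G i)" for i
    define W where "W = PiE I V"
    define T where "T x = {u \<in> W. u(j := x) \<in> S}" for x
    let ?P = "cartesian_product_graph I G"
    let ?P' = "cartesian_product_graph (insert j I) G"
    interpret H: pair_graph "G j" using insert.prems(1) by simp
    have finV: "finite (V i)" if "i \<in> insert j I" for i
      using insert.prems(3)[OF that] unfolding V_def by (metis card.infinite not_less_zero)
    have finVj: "finite (V j)" using finV by simp
    have finW: "finite W" unfolding W_def using finV insert.hyps(1) by (intro finite_PiE) auto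
    have finT: "finite (T x)" for x using finW unfolding T_def by simp
    have S: "S \<subseteq> PiE (insert j I) V" using insert.prems(4) unfolding V_def .
    \<comment> \<open>Tuples in \<open>W\<close> are \<open>undefined\<close> at \<open>j\<close>,
      so \<open>u(j := x)\<close> determines both \<open>u\<close> and \<open>x\<close>. All
      injectivity claims below rest on this.\<close>
    have ext: "(u(j := x))(j := undefined) = u" if "u \<in> W" for u x
      using PiE_upd_undefined insert.hyps(2) that unfolding W_def .
    have ext_cong: "u = v \<and> x = y" if "u(j := x) = v(j := y)" "u \<in> W" "v \<in> W" for u v x y
      using ext[OF that(2), of x] ext[OF that(3), of y] that(1) by (metis fun_upd_same)
    have TW: "T x \<subseteq> W" for x unfolding T_def by blast
    have upd: "u(j := x) \<in> PiE (insert j I) V" if "u \<in> W" "x \<in> V j" for u x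
      using that unfolding W_def by (auto simp: PiE_insert_eq)
    have S_eq: "S = (\<lambda>(x, u). u(j := x)) ` Sigma (V j) T"
    proof
      show "S \<subseteq> (\<lambda>(x, u). u(j := x)) ` Sigma (V j) T"
      proof
        fix s assume s: "s \<in> S"
        then have "s \<in> PiE (insert j I) V" using S by blast
        then obtain x u where "x \<in> V j" "u \<in> W" "s = u(j := x)"
          unfolding PiE_insert_eq W_def by auto
        then show "s \<in> (\<lambda>(x, u). u(j := x)) ` Sigma (V j) T"
          using s unfolding T_def by force
      qed
    qed (auto simp: T_def)
    have "inj_on (\<lambda>(x, u). u(j := x)) (Sigma (V j) T)"
      using ext_cong TW by (fastforce simp: inj_on_def)
    then have card_S: "card S = (\<Sum>x\<in>V j. card (T x))"
      by (subst S_eq) (simp add: card_image card_SigmaI finVj finT)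
    have finS: "finite S" using S_eq finVj finT by (metis finite_SigmaI finite_imageI)
    have S0: "card S > 0" using finS False by (simp add: card_gt_0_iff)
    then have W0: "W \<noteq> {}" using S_eq TW False by blast
    have ne: "V j \<noteq> {}" using S_eq False by blast
    define a where "a x = real (card (T x))" for x
    obtain p where p: "p \<in> V j" "\<And>x. x \<in> V j \<Longrightarrow> a x \<le> a p"
      using Max_in[of "a ` V j"] Max_ge[of "a ` V j"] finVj ne by fastforce
    obtain q where q: "q \<in> V j" "\<And>x. x \<in> V j \<Longrightarrow> a q \<le> a x"
      using Min_in[of "a ` V j"] Min_le[of "a ` V j"] finVj ne by fastforce
    have "\<exists>c d. (c, d) \<in> parcs (G j) \<and> u(j := c) \<in> S \<and> u(j := d) \<notin> S"
      if "u \<in> T p - T q" for u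
    proof -
      have "pair_graph (G j)" "Digraph_Component.connected (with_proj (G j))"
        using insert.prems(1,2) by auto
      moreover have "p \<in> pverts (G j)" "p \<in> {x. u(j := x) \<in> S}"
        "q \<in> pverts (G j)" "q \<notin> {x. u(j := x) \<in> S}"
        using p(1) q(1) that unfolding V_def T_def by auto
      ultimately obtain c d where "(c, d) \<in> parcs (G j)"
        "c \<in> {x. u(j := x) \<in> S}" "d \<notin> {x. u(j := x) \<in> S}"
        by (rule connected_arc_leaving)
      then show ?thesis by auto
    qed
    then obtain c d where cd: "\<And>u. u \<in> T p - T q \<Longrightarrow>
        (c u, d u) \<in> parcs (G j) \<and> u(j := c u) \<in> S \<and> u(j := d u) \<notin> S"
      by metis
    \<comment> \<open>\<open>F1\<close> lifts the boundary arcs of every slice; \<open>F2\<close>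
      takes one arc in direction \<open>j\<close> for each fibre that meets \<open>S\<close> at
      \<open>p\<close> but not at \<open>q\<close>.\<close>
    define F1 where "F1 = (\<lambda>(x, (u, v)). (u(j := x), v(j := x))) `
      Sigma (V j) (\<lambda>x. arc_boundary ?P (T x))"
    define F2 where "F2 = (\<lambda>u. (u(j := c u), u(j := d u))) ` (T p - T q)"
    have arcW: "u \<in> W \<and> v \<in> W" if "(u, v) \<in> parcs ?P" for u v
      using that unfolding cartesian_product_graph_def W_def V_def by simp
    have fin_arc: "finite (arc_boundary ?P A)" for A
      by (rule finite_subset[OF _ finite_SigmaI[OF finW finW]])
        (auto simp: arc_boundary_def dest: arcW)
    have F1_sub: "F1 \<subseteq> arc_boundary ?P' S"
    proof
      fix e assume "e \<in> F1"
      then obtain x u v where x: "x \<in> V j" and uv: "(u, v) \<in> arc_boundary ?P (T x)"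
        and e: "e = (u(j := x), v(j := x))" unfolding F1_def by auto
      then obtain i where i: "i \<in> I" "(u i, v i) \<in> parcs (G i)"
        "\<forall>m\<in>I. m \<noteq> i \<longrightarrow> u m = v m"
        unfolding arc_boundary_def cartesian_product_graph_def by auto
      have W: "u \<in> W" "v \<in> W" using uv arcW unfolding arc_boundary_def by auto
      have "i \<noteq> j" using i(1) insert.hyps(2) by blast
      then have "\<exists>i\<in>insert j I. ((u(j := x)) i, (v(j := x)) i) \<in> parcs (G i) \<and>
          (\<forall>m\<in>insert j I. m \<noteq> i \<longrightarrow> (u(j := x)) m = (v(j := x)) m)"
        using i by (intro bexI[of _ i]) auto
      moreover have "u(j := x) \<in> S" "v(j := x) \<notin> S"
        using uv W unfolding arc_boundary_def T_def by auto
      ultimately show "e \<in> arc_boundary ?P' S"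
        using upd[OF W(1) x] upd[OF W(2) x]
        unfolding e arc_boundary_def cartesian_product_graph_def V_def by simp
    qed
    have F2_sub: "F2 \<subseteq> arc_boundary ?P' S"
    proof
      fix e assume "e \<in> F2"
      then obtain u where u: "u \<in> T p - T q" and e: "e = (u(j := c u), u(j := d u))"
        unfolding F2_def by auto
      have arc: "(c u, d u) \<in> parcs (G j)" using cd[OF u] by simp
      then have V: "c u \<in> V j" "d u \<in> V j" unfolding V_def using H.in_arcsD1 H.in_arcsD2 by auto
      have W: "u \<in> W" using u TW by blast
      show "e \<in> arc_boundary ?P' S"
        using upd[OF W V(1)] upd[OF W V(2)] cd[OF u]
        unfolding e arc_boundary_def cartesian_product_graph_def V_def by auto
    qed
    \<comment> \<open>Arcs in \<open>F1\<close> keep coordinate \<open>j\<close>, those in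
      \<open>F2\<close> change it.\<close>
    have disj: "F1 \<inter> F2 = {}"
    proof -
      have "fst e j = snd e j" if "e \<in> F1" for e using that unfolding F1_def by auto
      moreover have "fst e j \<noteq> snd e j" if e: "e \<in> F2" for e
      proof -
        obtain u where u: "u \<in> T p - T q" and e: "e = (u(j := c u), u(j := d u))"
          using e unfolding F2_def by auto
        show ?thesis using cd[OF u] H.pair_no_loops e by fastforce
      qed
      ultimately show ?thesis by blast
    qed
    have "inj_on (\<lambda>(x, (u, v)). (u(j := x), v(j := x)))
        (Sigma (V j) (\<lambda>x. arc_boundary ?P (T x)))"
    proof (rule inj_onI)
      fix e e'
      assume in_Sigma: "e \<in> Sigma (V j) (\<lambda>x. arc_boundary ?P (T x))"
        "e' \<in> Sigma (V j) (\<lambda>x. arc_boundary ?P (T x))"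
        and eq: "(\<lambda>(x, (u, v)). (u(j := x), v(j := x))) e
          = (\<lambda>(x, (u, v)). (u(j := x), v(j := x))) e'"
      obtain x u v x' u' v' where e: "e = (x, (u, v))" "e' = (x', (u', v'))"
        by (metis prod.exhaust)
      have "u \<in> W" "v \<in> W" "u' \<in> W" "v' \<in> W"
        using in_Sigma arcW unfolding e arc_boundary_def by auto
      moreover have "u(j := x) = u'(j := x')" "v(j := x) = v'(j := x')" using eq e by auto
      ultimately show "e = e'" unfolding e using ext_cong by blast
    qed
    then have card_F1: "card F1 = (\<Sum>x\<in>V j. card (arc_boundary ?P (T x)))"
      unfolding F1_def by (simp add: card_image card_SigmaI finVj fin_arc)
    have "inj_on (\<lambda>u. (u(j := c u), u(j := d u))) (T p - T q)"
      using ext_cong TW by (fastforce simp: inj_on_def)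
    then have "card F2 = card (T p - T q)" unfolding F2_def by (simp add: card_image)
    \<comment> \<open>Only an inequality, since \<open>T q\<close> need not be contained in
      \<open>T p\<close>.\<close>
    then have card_F2: "real (card F2) \<ge> a p - a q"
      unfolding a_def using diff_card_le_card_Diff[OF finT[of q], of "T p"] by linarith
    have "finite (PiE (insert j I) V)" using finV insert.hyps(1) by (intro finite_PiE) auto
    then have "finite (arc_boundary ?P' S)"
      by (intro finite_subset[OF _ finite_SigmaI[of "PiE (insert j I) V" "\<lambda>_. PiE (insert j I) V"]])
        (auto simp: arc_boundary_def cartesian_product_graph_def V_def)
    then have "card (F1 \<union> F2) \<le> card (arc_boundary ?P' S)"
      using F1_sub F2_sub by (intro card_mono) auto
    moreover have "card (F1 \<union> F2) = card F1 + card F2"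
      unfolding F1_def F2_def
      by (rule card_Un_disjoint[OF _ _ disj[unfolded F1_def F2_def]])
        (auto intro!: finite_SigmaI simp: finVj fin_arc finT)
    ultimately have bnd: "(\<Sum>x\<in>V j. real (card (arc_boundary ?P (T x)))) + (a p - a q)
        \<le> real (card (arc_boundary ?P' S))"
      using card_F1 card_F2 by (simp flip: of_nat_sum)
    \<comment> \<open>\<open>K\<close> depends on \<open>C\<close> alone, so one constant serves
      both the slices and the new direction, where \<open>m \<le> C\<close> is used.\<close>
    define K where "K = (real C - 1) * ln (real C)"
    define m where "m = card (V j)"
    define N where "N = real (card W)"
    have IH: "a x * ln (N / a x) \<le> K * real (card (arc_boundary ?P (T x)))" for x
    proof -
      have "T x \<subseteq> (\<Pi>\<^sub>E i\<in>I. pverts (G i))" using TW unfolding W_def V_def .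
      then show ?thesis unfolding a_def N_def K_def W_def V_def
        using insert.prems(1-3) by (intro insert.IH) auto
    qed
    have m: "1 < m" "m \<le> C" using insert.prems(3)[of j] unfolding m_def V_def by auto
    have mK: "(real m - 1) * ln (real m) \<le> K"
      unfolding K_def using m by (intro mult_mono) auto
    have sum_a: "sum a (V j) = real (card S)" unfolding a_def card_S by simp
    \<comment> \<open>With \<open>N\<close> the order of the smaller product, \<open>m * N\<close>
      is that of the full product.\<close>
    have "real (card S) * ln (real m * N / real (card S))
        \<le> (\<Sum>x\<in>V j. a x * ln (N / a x)) + (real m - 1) * ln (real m) * (a p - a q)"
      unfolding sum_a[symmetric] m_def
      by (rule entropy_max_min_bound)
        (use finVj p q S0 sum_a finW W0 in \<open>auto simp: a_def N_def card_gt_0_iff\<close>)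
    also have "\<dots> \<le> (\<Sum>x\<in>V j. K * real (card (arc_boundary ?P (T x)))) + K * (a p - a q)"
      using IH mK p(2)[OF q(1)] by (intro add_mono sum_mono mult_right_mono) auto
    also have "\<dots> = K * ((\<Sum>x\<in>V j. real (card (arc_boundary ?P (T x)))) + (a p - a q))"
      by (simp add: sum_distrib_left distrib_left)
    also have "\<dots> \<le> K * real (card (arc_boundary ?P' S))"
      using bnd C unfolding K_def by (intro mult_left_mono) auto
    also have "real m * N = real (card (PiE (insert j I) V))"
      using insert.hyps unfolding m_def N_def W_def by (simp add: card_PiE)
    finally show ?thesis unfolding K_def V_def .
  qed
qed

section \<open>From boundary arcs to the isoperimetric number\<close>

theorem theorem2:
  fixes C t n k :: nat
    and G :: "nat \<Rightarrow> 'a pair_pre_digraph"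
    and P :: "(nat \<Rightarrow> 'a) pair_pre_digraph"
  assumes "C > 1"
    and "\<And>j. j \<in> {1..t} \<Longrightarrow> pair_graph (G j)"
    and "\<And>j. j \<in> {1..t} \<Longrightarrow> Digraph_Component.connected (with_proj (G j))"
    and "\<And>j. j \<in> {1..t} \<Longrightarrow> 1 < card (pverts (G j)) \<and> card (pverts (G j)) \<le> C"
    and "P = cartesian_product_graph {1..t} G"
    and "n = card (pverts P)"
    and "k \<in> {1..n}"
  shows "isoperimetric_number k P \<ge> 1 / (real C - 1) * log (real C) (real n / real k)"
proof -
  let ?A = "{real (card (edge_boundary P S)) / real k | S. S \<subseteq> pverts P \<and> card S = k}"
  have P: "pair_graph P"
    unfolding assms(5) by (rule pair_graph_cartesian_product_graph) (use assms(2) in auto)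
  then interpret pair_graph P .
  have verts: "pverts P = (\<Pi>\<^sub>E j\<in>{1..t}. pverts (G j))"
    unfolding assms(5) by (simp add: cartesian_product_graph_def)
  have "finite ?A"
    by (rule finite_surj[of "Pow (pverts P)" _ "\<lambda>S. real (card (edge_boundary P S)) / real k"])
      (use pair_finite_verts in auto)
  \<comment> \<open>As \<open>k\<close> is at most \<open>n\<close>, a set of size \<open>k\<close>
    exists, so the minimum is attained by some \<open>S\<close>.\<close>
  moreover have "?A \<noteq> {}"
    using assms(6,7) obtain_subset_with_card_n[of k "pverts P"] by auto
  ultimately have "isoperimetric_number k P \<in> ?A"
    unfolding isoperimetric_number_def by (rule Min_in)
  then obtain S where S: "S \<subseteq> pverts P" "card S = k"
    and iso: "isoperimetric_number k P = real (card (edge_boundary P S)) / real k"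
    by blast
  have "real k * ln (real n / real k) \<le> (real C - 1) * ln (real C) * real (card (edge_boundary P S))"
    using card_arc_boundary_product[of C "{1..t}" G S] assms S
    unfolding card_edge_boundary[OF P] verts by (simp add: verts)
  \<comment> \<open>These signs permit division by \<open>k\<close>, \<open>C - 1\<close> and
    \<open>ln C\<close>; the last turns \<open>ln\<close> into the logarithm to base
    \<open>C\<close>.\<close>
  moreover have "ln (real C) > 0" "real C - 1 > 0" "real k > 0" using assms(1,7) by auto
  ultimately show ?thesis unfolding iso log_def by (simp add: field_simps)
qed

end
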